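(* For any positive integer $d$ there is an instance of the Single-bid Auction in which all bidders have valuations in $\mathrm{SAW}\text{-}d$, and whose price of stability is at least $d+1-\varepsilon/d$ for any $\varepsilon>0$.
   Context: Valuations are normalized monotone set functions $f:2^{[m]}\to\mathbb{R}_{\ge0}$ over the item set $[m]$. Write $f(S\mid T)=f(S\cup T)-f(T)$. A set $T$ is superadditive w.r.t. $f$ if there exists $S\subseteq[m]\setminus T$ with $f(S\mid T)>\max_{T'\subsetneq T} f(S\mid T')$; $\mathrm{SAW}(f)$ is the maximum cardinality of a nonempty superadditive set (0 if none), and $\mathrm{SAW}\text{-}d$ is the class of $f$ with $\mathrm{SAW}(f)\le d$. Single-bid Auction: each bidder submits a single nonnegative bid; bidders are processed in decreasing order of bids, and each in turn may take any subset of the still-available items, paying its bid for each item taken. The price of stability is the ratio of the optimal social welfare to the welfare of the best equilibrium. *)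

theory Defs
  imports "HOL-Probability.Probability"
begin

definition valuation :: "'a set \<Rightarrow> ('a set \<Rightarrow> real) \<Rightarrow> bool" where
  "valuation U f \<longleftrightarrow>
     f {} = 0 \<and> (\<forall>S\<subseteq>U. 0 \<le> f S) \<and> (\<forall>S T. S \<subseteq> T \<longrightarrow> T \<subseteq> U \<longrightarrow> f S \<le> f T)"

definition marginal :: "('a set \<Rightarrow> real) \<Rightarrow> 'a set \<Rightarrow> 'a set \<Rightarrow> real" where
  "marginal f S T = f (S \<union> T) - f T"

(* Only used for finite nonempty T, where the maximum ranges over a finite nonempty set. *)
definition superadditive_set :: "'a set \<Rightarrow> ('a set \<Rightarrow> real) \<Rightarrow> 'a set \<Rightarrow> bool" where
  "superadditive_set U f T \<longleftrightarrow>
     T \<subseteq> U \<and> (\<exists>S\<subseteq>U - T. marginal f S T > Max {marginal f S T' | T'. T' \<subset> T})"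

definition SAW :: "'a set \<Rightarrow> ('a set \<Rightarrow> real) \<Rightarrow> nat" where
  "SAW U f = Max (insert 0 {card T | T. T \<noteq> {} \<and> superadditive_set U f T})"

definition SAW_class :: "'a set \<Rightarrow> nat \<Rightarrow> ('a set \<Rightarrow> real) set" where
  "SAW_class U d = {f. valuation U f \<and> SAW U f \<le> d}"

(* Bidders are 0, ..., bidders - 1 and items are 0, ..., items - 1. *)
record auction =
  bidders :: nat
  items :: nat
  val :: "nat \<Rightarrow> nat set \<Rightarrow> real"

(* A strategy is a bid together with a rule telling which items to take when it is the
   bidder's turn, as a function of the set of items that are still available. *)
type_synonym strategy = "real \<times> (nat set \<Rightarrow> nat set)"

definition strategies :: "auction \<Rightarrow> strategy set" where
  "strategies I = {(b, c). 0 \<le> b \<and> (\<forall>A\<subseteq>{..<items I}. c A \<subseteq> A)}"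

(* sort_key is stable, so among equal bids the bidder with the smaller index comes first;
   any other fixed priority among tied bidders is obtained by renumbering them. *)
definition processing_order :: "auction \<Rightarrow> (nat \<Rightarrow> strategy) \<Rightarrow> nat list" where
  "processing_order I s = sort_key (\<lambda>i. - fst (s i)) [0..<bidders I]"

fun process :: "(nat \<Rightarrow> strategy) \<Rightarrow> nat list \<Rightarrow> nat set \<Rightarrow> nat \<Rightarrow> nat set" where
  "process s [] A = (\<lambda>_. {})"
| "process s (i # is) A = (process s is (A - snd (s i) A))(i := snd (s i) A)"

definition outcome :: "auction \<Rightarrow> (nat \<Rightarrow> strategy) \<Rightarrow> nat \<Rightarrow> nat set" where
  "outcome I s = process s (processing_order I s) {..<items I}"

definition utility :: "auction \<Rightarrow> nat \<Rightarrow> (nat \<Rightarrow> strategy) \<Rightarrow> real" where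
  "utility I i s = val I i (outcome I s i) - fst (s i) * real (card (outcome I s i))"

definition welfare :: "auction \<Rightarrow> (nat \<Rightarrow> nat set) \<Rightarrow> real" where
  "welfare I X = (\<Sum>i<bidders I. val I i (X i))"

definition allocations :: "auction \<Rightarrow> (nat \<Rightarrow> nat set) set" where
  "allocations I =
     {X. (\<forall>i<bidders I. X i \<subseteq> {..<items I}) \<and> disjoint_family_on X {..<bidders I}}"

definition optimal_welfare :: "auction \<Rightarrow> real" where
  "optimal_welfare I = (SUP X\<in>allocations I. welfare I X)"

definition pure_equilibria :: "auction \<Rightarrow> (nat \<Rightarrow> strategy) set" where
  "pure_equilibria I =
     {s. (\<forall>i<bidders I. s i \<in> strategies I) \<and>
         (\<forall>i<bidders I. \<forall>t\<in>strategies I. utility I i (s(i := t)) \<le> utility I i s)}"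

definition strategy_space :: "strategy measure" where
  "strategy_space = borel \<Otimes>\<^sub>M count_space UNIV"

definition joint :: "auction \<Rightarrow> (nat \<Rightarrow> strategy measure) \<Rightarrow> (nat \<Rightarrow> strategy) measure" where
  "joint I \<sigma> = Pi\<^sub>M {..<bidders I} \<sigma>"

(* Integrability is required because the Bochner integral of a non-integrable function is 0,
   which would give a strategy with infinite expected payment the utility 0. It excludes no
   genuine equilibrium: utilities are bounded above, and taking nothing guarantees 0. *)
definition mixed_equilibria :: "auction \<Rightarrow> (nat \<Rightarrow> strategy measure) set" where
  "mixed_equilibria I =
     {\<sigma>. (\<forall>i<bidders I. prob_space (\<sigma> i) \<and> sets (\<sigma> i) = sets strategy_space \<and>
              (AE t in \<sigma> i. t \<in> strategies I)) \<and>
         (\<forall>i<bidders I. integrable (joint I \<sigma>) (utility I i) \<and>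
              (\<forall>t\<in>strategies I.
                 (\<integral>s. utility I i (s(i := t)) \<partial>joint I \<sigma>) \<le> (\<integral>s. utility I i s \<partial>joint I \<sigma>)))}"

definition pure_price_of_stability :: "auction \<Rightarrow> real" where
  "pure_price_of_stability I =
     optimal_welfare I / (SUP s\<in>pure_equilibria I. welfare I (outcome I s))"

definition mixed_price_of_stability :: "auction \<Rightarrow> real" where
  "mixed_price_of_stability I =
     optimal_welfare I /
       (SUP \<sigma>\<in>mixed_equilibria I. \<integral>s. welfare I (outcome I s) \<partial>joint I \<sigma>)"

end

theory Submission imports Defs begin

text \<open>
  There are $d+1$ items. Bidder 0 has value 1 for any nonempty bundle; bidder 1 has value
  $(d+1)\beta$, with $\beta < 1$ close to 1, for the set of all items and 0 for anything else. A nonempty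
  superadditive set is a proper subset of the items, so every valuation has width at most $d$.
  Bidder 1 pays its bid on all $d+1$ items, so it cannot afford a bid above $\beta$, whereas bidder 0
  gains from a single item at price $\beta$. Hence bidder 1 never obtains all items in equilibrium
  and the equilibrium welfare is at most 1, while the optimum is at least $(d+1)\beta$.

  For mixed equilibria, let $u$ be the expected utility of bidder 1. If $u = 0$, then no bid below
  $\beta$ may be profitable for bidder 1, so bidder 0 almost surely bids at least $\beta$ and takes an
  item when it comes first; and a bidder 1 bidding above $\beta$ takes nothing. If $u > 0$, then bidder
  1 almost surely bids below $\beta$, so bidder 0 secures $1 - \beta > 0$; but then both bidders win
  with probability bounded below at almost all of their bids, which is impossible at the bottom
  of the bid distributions.
\<close>

section \<open>Width, expectations and product measures\<close>

text \<open>The empty set has marginal 0 over every set, so it cannot witness a strict inequality; a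
  witness is nonempty and disjoint from \<open>T\<close>, which leaves \<open>T\<close> a proper
  subset of \<open>U\<close>.\<close>

lemma SAW_le_card_pred:
  assumes "finite U"
  shows "SAW U f \<le> card U - 1"
proof -
  have "card T \<le> card U - 1" if "T \<noteq> {}" and sup: "superadditive_set U f T" for T
  proof -
    obtain S where "T \<subseteq> U" and S: "S \<subseteq> U - T"
      and gt: "marginal f S T > Max {marginal f S T' | T'. T' \<subset> T}"
      using sup by (auto simp: superadditive_set_def)
    have "finite T" using \<open>T \<subseteq> U\<close> assms by (rule finite_subset)
    have "{marginal f S T' | T'. T' \<subset> T} \<subseteq> marginal f S ` Pow T" by auto
    with \<open>finite T\<close> have "finite {marginal f S T' | T'. T' \<subset> T}"
      by (meson finite_Pow_iff finite_imageI finite_subset)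
    \<comment> \<open>Comparison with \<open>T' = {}\<close> alone suffices; it is a proper subset
      because \<open>T\<close> is nonempty.\<close>
    moreover have "marginal f S {} \<in> {marginal f S T' | T'. T' \<subset> T}"
      using \<open>T \<noteq> {}\<close> by blast
    ultimately have "marginal f S {} < marginal f S T"
      using gt Max_ge by fastforce
    then have "S \<noteq> {}" by (auto simp: marginal_def)
    with S have "T \<subset> U" using \<open>T \<subseteq> U\<close> by auto
    then have "card T < card U" using assms by (simp add: psubset_card_mono)
    then show ?thesis by simp
  qed
  moreover have "finite {card T | T. T \<noteq> {} \<and> superadditive_set U f T}"
  proof (rule finite_subset)
    show "{card T | T. T \<noteq> {} \<and> superadditive_set U f T} \<subseteq> card ` Pow U"
      by (auto simp: superadditive_set_def)
  qed (use assms in simp)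
  ultimately show ?thesis unfolding SAW_def by (subst Max_le_iff) auto
qed

text \<open>The slack \<open>integral\<^sup>L M f - f x\<close> is nonnegative with mean 0, hence
  vanishes almost surely. For equilibria this turns "no strategy beats the average" into "almost
  every strategy attains the average".\<close>

lemma (in prob_space) AE_eq_of_AE_le_integral:
  fixes f :: "'a \<Rightarrow> real"
  assumes int: "integrable M f" and le: "AE x in M. f x \<le> integral\<^sup>L M f"
  shows "AE x in M. f x = integral\<^sup>L M f"
proof -
  have "AE x in M. integral\<^sup>L M f - f x = 0"
  proof (subst integral_nonneg_eq_0_iff_AE[symmetric])
    show "(\<integral>x. integral\<^sup>L M f - f x \<partial>M) = 0"
      using int by (simp add: prob_space)
  qed (use int le in auto)
  then show ?thesis by eventually_elim simp
qed

text \<open>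
  By right-continuity the set of all b with P(g \<le> b) \<ge> \<kappa> has a least element b0. Then f \<ge> b0
  almost surely, so values of g below or at b0, which occur with positive probability, exceed f
  with probability 0.
\<close>

lemma no_mutual_undercutting:
  fixes f :: "'a \<Rightarrow> real" and g :: "'b \<Rightarrow> real"
  assumes "prob_space M" and "prob_space N"
    and [measurable]: "f \<in> borel_measurable M" "g \<in> borel_measurable N"
    and "0 < \<kappa>" and "0 < \<mu>"
    and f: "AE x in M. \<kappa> \<le> measure N {y \<in> space N. g y \<le> f x}"
    and g: "AE y in N. \<mu> \<le> measure M {x \<in> space M. f x < g y}"
  shows False
proof -
  interpret M: prob_space M by fact
  interpret N: prob_space N by fact
  interpret G: real_distribution "distr N borel g"
    by (simp add: N.real_distribution_distr)
  define B where "B = {b. \<kappa> \<le> cdf (distr N borel g) b}"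
  have cdf_eq: "cdf (distr N borel g) b = measure N {y \<in> space N. g y \<le> b}" for b
    by (simp add: cdf_def measure_distr vimage_def Int_def conj_commute)
  have "\<forall>\<^sub>F b in at_bot. cdf (distr N borel g) b < \<kappa>"
    using G.cdf_lim_at_bot \<open>0 < \<kappa>\<close> by (rule order_tendstoD)
  then obtain l where l: "\<And>b. b \<le> l \<Longrightarrow> cdf (distr N borel g) b < \<kappa>"
    by (auto simp: eventually_at_bot_linorder)
  then have bdd: "bdd_below B"
    by (intro bdd_belowI[of _ l]) (metis B_def linorder_le_cases mem_Collect_eq not_less)
  have AE_B: "AE x in M. f x \<in> B" using f by (simp add: B_def cdf_eq)
  then have "B \<noteq> {}" using M.AE_False by force
  have "Inf B \<in> B"
  proof (rule ccontr)
    assume "Inf B \<notin> B"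
    then have "cdf (distr N borel g) (Inf B) < \<kappa>" by (simp add: B_def)
    moreover have "(cdf (distr N borel g) \<longlongrightarrow> cdf (distr N borel g) (Inf B)) (at_right (Inf B))"
      using G.cdf_is_right_cont by (simp add: continuous_within)
    ultimately have "\<forall>\<^sub>F b in at_right (Inf B). cdf (distr N borel g) b < \<kappa>"
      by (rule order_tendstoD(2)[rotated])
    then obtain c where c: "Inf B < c" "\<And>b. Inf B < b \<Longrightarrow> b < c \<Longrightarrow> cdf (distr N borel g) b < \<kappa>"
      by (auto simp: eventually_at_right_field)
    obtain b where "b \<in> B" "b < c"
      using cInf_lessD[OF \<open>B \<noteq> {}\<close> c(1)] by auto
    moreover have "Inf B < b"
      using cInf_lower[OF \<open>b \<in> B\<close> bdd] \<open>Inf B \<notin> B\<close> \<open>b \<in> B\<close> by (metis order_le_less)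
    ultimately show False using c(2)[of b] by (simp add: B_def)
  qed
  have "AE x in M. Inf B \<le> f x"
    using AE_B by eventually_elim (rule cInf_lower[OF _ bdd])
  then have "measure M {x \<in> space M. f x < Inf B} = 0"
    by (subst M.prob_eq_0) (auto elim!: eventually_mono)
  moreover have "\<exists>y\<in>space N. g y \<le> Inf B \<and> \<mu> \<le> measure M {x \<in> space M. f x < g y}"
  proof (rule ccontr)
    assume "\<not> ?thesis"
    with g have "AE y in N. \<not> g y \<le> Inf B"
      by (auto elim!: AE_mp)
    then have "measure N {y \<in> space N. g y \<le> Inf B} = 0"
      by (subst N.prob_eq_0) auto
    with \<open>Inf B \<in> B\<close> \<open>0 < \<kappa>\<close> show False by (simp add: B_def cdf_eq)
  qed
  then obtain y where "g y \<le> Inf B" "\<mu> \<le> measure M {x \<in> space M. f x < g y}" by blast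
  \<comment> \<open>Strictness in the hypothesis on \<open>g\<close> is essential: with
    \<open>g y \<le> Inf B\<close> it puts \<open>f x\<close> strictly below \<open>Inf B\<close>, a
    null event. With weak inequalities in both hypotheses, equal constants would satisfy
    them.\<close>
  moreover have "measure M {x \<in> space M. f x < g y} \<le> measure M {x \<in> space M. f x < Inf B}"
    using \<open>g y \<le> Inf B\<close> by (intro M.finite_measure_mono) auto
  ultimately show False using \<open>0 < \<mu>\<close> by simp
qed

text \<open>The preimage of a rectangle is a cylinder over \<open>{i, j}\<close>, on which both
  measures agree. This moves expectations from the indexed product to a binary product, where Fubini
  applies.\<close>

lemma distr_PiM_pair:
  assumes "i \<in> I" "j \<in> I" "i \<noteq> j" and prob: "\<And>k. k \<in> I \<Longrightarrow> prob_space (M k)"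
  shows "distr (Pi\<^sub>M I M) (M i \<Otimes>\<^sub>M M j) (\<lambda>s. (s i, s j)) = M i \<Otimes>\<^sub>M M j"
proof (rule pair_measure_eqI[symmetric])
  show "sigma_finite_measure (M i)" "sigma_finite_measure (M j)"
    using prob assms by (auto simp: prob_space_imp_sigma_finite)
  fix A B assume A: "A \<in> sets (M i)" and B: "B \<in> sets (M j)"
  have meas: "(\<lambda>s. (s i, s j)) \<in> Pi\<^sub>M I M \<rightarrow>\<^sub>M M i \<Otimes>\<^sub>M M j"
    using assms by measurable
  have "(\<lambda>s. (s i, s j)) -` (A \<times> B) \<inter> space (Pi\<^sub>M I M) =
      prod_emb I M {i, j} (\<Pi>\<^sub>E k\<in>{i, j}. if k = i then A else B)"
    using assms by (auto simp: prod_emb_def space_PiM PiE_iff)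
  then have "emeasure (distr (Pi\<^sub>M I M) (M i \<Otimes>\<^sub>M M j) (\<lambda>s. (s i, s j))) (A \<times> B) =
      emeasure (Pi\<^sub>M I M) (prod_emb I M {i, j} (\<Pi>\<^sub>E k\<in>{i, j}. if k = i then A else B))"
    using A B meas by (simp add: emeasure_distr)
  also have "\<dots> = (\<Prod>k\<in>{i, j}. emeasure (M k) (if k = i then A else B))"
    using assms A B by (intro emeasure_PiM_emb) auto
  finally show "emeasure (M i) A * emeasure (M j) B =
      emeasure (distr (Pi\<^sub>M I M) (M i \<Otimes>\<^sub>M M j) (\<lambda>s. (s i, s j))) (A \<times> B)"
    using assms by simp
qed simp

section \<open>Auctions with two bidders\<close>

text \<open>With two bidders, x is the strategy of bidder 0, who comes first in case of a tie.\<close>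

definition bundle0 :: "auction \<Rightarrow> strategy \<Rightarrow> strategy \<Rightarrow> nat set" where
  "bundle0 I x y = (if fst y \<le> fst x then snd x {..<items I}
                    else snd x ({..<items I} - snd y {..<items I}))"

definition bundle1 :: "auction \<Rightarrow> strategy \<Rightarrow> strategy \<Rightarrow> nat set" where
  "bundle1 I x y = (if fst y \<le> fst x then snd y ({..<items I} - snd x {..<items I})
                    else snd y {..<items I})"

definition payoff0 :: "auction \<Rightarrow> strategy \<Rightarrow> strategy \<Rightarrow> real" where
  "payoff0 I x y = val I 0 (bundle0 I x y) - fst x * real (card (bundle0 I x y))"

definition payoff1 :: "auction \<Rightarrow> strategy \<Rightarrow> strategy \<Rightarrow> real" where
  "payoff1 I x y = val I 1 (bundle1 I x y) - fst y * real (card (bundle1 I x y))"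

lemma outcome_two_bidders:
  assumes "bidders I = 2"
  shows "outcome I s 0 = bundle0 I (s 0) (s 1)" and "outcome I s 1 = bundle1 I (s 0) (s 1)"
  using assms
  by (simp_all add: outcome_def processing_order_def bundle0_def bundle1_def upt_conv_Cons
      numeral_2_eq_2)

lemma utility_two_bidders:
  assumes "bidders I = 2"
  shows "utility I 0 s = payoff0 I (s 0) (s 1)" and "utility I 1 s = payoff1 I (s 0) (s 1)"
  using outcome_two_bidders[OF assms]
  by (simp_all add: utility_def payoff0_def payoff1_def)

lemma welfare_two_bidders:
  assumes "bidders I = 2"
  shows "welfare I (outcome I s) =
    val I 0 (bundle0 I (s 0) (s 1)) + val I 1 (bundle1 I (s 0) (s 1))"
  using outcome_two_bidders[OF assms, of s] by (simp add: welfare_def assms numeral_2_eq_2)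

section \<open>Measurability of bundles, payoffs and welfare\<close>

lemma space_strategy_space [simp]: "space strategy_space = UNIV"
  by (simp add: strategy_space_def space_pair_measure)

lemma measurable_bid [measurable]: "fst \<in> borel_measurable strategy_space"
  by (simp add: strategy_space_def)

lemma measurable_rule [measurable]: "(\<lambda>x. snd x A) \<in> strategy_space \<rightarrow>\<^sub>M count_space UNIV"
  unfolding strategy_space_def
  by (rule measurable_compose[OF measurable_snd measurable_count_space])

text \<open>The codomain is restricted to the finite set \<open>Pow {..<n}\<close> so that the
  leftover items can serve as a countable index when the other bidder's rule is applied to
  them.\<close>

lemma measurable_leftover:
  "(\<lambda>x. {..<n} - snd x A) \<in> strategy_space \<rightarrow>\<^sub>M count_space (Pow {..<n})"
  by (rule measurable_compose[OF measurable_rule]) (auto simp: measurable_count_space_eq1)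

lemma measurable_bundles:
  shows measurable_bundle0 [measurable]:
    "(\<lambda>p. bundle0 I (fst p) (snd p)) \<in> strategy_space \<Otimes>\<^sub>M strategy_space \<rightarrow>\<^sub>M count_space UNIV"
    and measurable_bundle1 [measurable]:
    "(\<lambda>p. bundle1 I (fst p) (snd p)) \<in> strategy_space \<Otimes>\<^sub>M strategy_space \<rightarrow>\<^sub>M count_space UNIV"
proof -
  let ?P = "strategy_space \<Otimes>\<^sub>M strategy_space"
  \<comment> \<open>The rule and the set it is applied to are both random; splitting over the
    finitely many leftover sets \<open>A\<close> reduces this to evaluation at a fixed
    \<open>A\<close>.\<close>
  have [measurable]: "(\<lambda>p. snd (fst p) ({..<items I} - snd (snd p) {..<items I})) \<in> ?P \<rightarrow>\<^sub>M count_space UNIV"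
    by (rule measurable_compose_countable'[where I="Pow {..<items I}" and
          f="\<lambda>A p. snd (fst p) A" and g="\<lambda>p. {..<items I} - snd (snd p) {..<items I}"])
      (auto intro: measurable_compose[OF measurable_snd measurable_leftover] countable_finite
        measurable_compose[OF measurable_fst measurable_rule])
  have [measurable]: "(\<lambda>p. snd (snd p) ({..<items I} - snd (fst p) {..<items I})) \<in> ?P \<rightarrow>\<^sub>M count_space UNIV"
    by (rule measurable_compose_countable'[where I="Pow {..<items I}" and
          f="\<lambda>A p. snd (snd p) A" and g="\<lambda>p. {..<items I} - snd (fst p) {..<items I}"])
      (auto intro: measurable_compose[OF measurable_fst measurable_leftover] countable_finite
        measurable_compose[OF measurable_snd measurable_rule])
  show "(\<lambda>p. bundle0 I (fst p) (snd p)) \<in> ?P \<rightarrow>\<^sub>M count_space UNIV"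
    unfolding bundle0_def by measurable
  show "(\<lambda>p. bundle1 I (fst p) (snd p)) \<in> ?P \<rightarrow>\<^sub>M count_space UNIV"
    unfolding bundle1_def by measurable
qed

lemma measurable_of_bundles [measurable]:
  fixes h :: "nat set \<Rightarrow> real"
  shows "(\<lambda>p. h (bundle0 I (fst p) (snd p))) \<in> borel_measurable (strategy_space \<Otimes>\<^sub>M strategy_space)"
    and "(\<lambda>p. h (bundle1 I (fst p) (snd p))) \<in> borel_measurable (strategy_space \<Otimes>\<^sub>M strategy_space)"
  by (auto intro: measurable_compose[OF measurable_bundle0] measurable_compose[OF measurable_bundle1])

lemma
  shows measurable_payoff0 [measurable]:
    "(\<lambda>p. payoff0 I (fst p) (snd p)) \<in> borel_measurable (strategy_space \<Otimes>\<^sub>M strategy_space)"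
    and measurable_payoff1 [measurable]:
    "(\<lambda>p. payoff1 I (fst p) (snd p)) \<in> borel_measurable (strategy_space \<Otimes>\<^sub>M strategy_space)"
  unfolding payoff0_def payoff1_def
  by (intro borel_measurable_diff borel_measurable_times measurable_of_bundles
      measurable_compose[OF measurable_fst measurable_bid]
      measurable_compose[OF measurable_snd measurable_bid])+

lemma measurable_welfare_two_bidders:
  "(\<lambda>p. val I 0 (bundle0 I (fst p) (snd p)) + val I 1 (bundle1 I (fst p) (snd p)))
     \<in> borel_measurable (strategy_space \<Otimes>\<^sub>M strategy_space)"
  by (intro borel_measurable_add measurable_of_bundles)

section \<open>Mixed strategies of two independent bidders\<close>

locale two_bidder_play =
  fixes I :: auction and \<sigma> :: "nat \<Rightarrow> strategy measure"
  assumes two: "bidders I = 2"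
    and prob: "\<And>i. i < 2 \<Longrightarrow> prob_space (\<sigma> i)"
    and sets_\<sigma>: "\<And>i. i < 2 \<Longrightarrow> sets (\<sigma> i) = sets strategy_space"
begin

sublocale P0: prob_space "\<sigma> 0" by (rule prob) simp
sublocale P1: prob_space "\<sigma> 1" by (rule prob) simp
sublocale P: pair_prob_space "\<sigma> 0" "\<sigma> 1" ..

lemma sets_\<sigma>01 [measurable_cong, simp]:
  "sets (\<sigma> 0) = sets strategy_space" "sets (\<sigma> 1) = sets strategy_space"
  "sets (\<sigma> (Suc 0)) = sets strategy_space"
  using sets_\<sigma>[of 0] sets_\<sigma>[of 1] by simp_all

lemma space_\<sigma>01 [simp]: "space (\<sigma> 0) = UNIV" "space (\<sigma> 1) = UNIV" "space (\<sigma> (Suc 0)) = UNIV"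
  using sets_\<sigma>01[THEN sets_eq_imp_space_eq] by simp_all

lemma distr_joint: "distr (joint I \<sigma>) (\<sigma> 0 \<Otimes>\<^sub>M \<sigma> 1) (\<lambda>s. (s 0, s 1)) = \<sigma> 0 \<Otimes>\<^sub>M \<sigma> 1"
  unfolding joint_def two by (rule distr_PiM_pair) (auto intro: prob)

lemma measurable_joint [measurable]: "(\<lambda>s. (s 0, s 1)) \<in> joint I \<sigma> \<rightarrow>\<^sub>M \<sigma> 0 \<Otimes>\<^sub>M \<sigma> 1"
  unfolding joint_def two by (intro measurable_Pair measurable_component_singleton) auto

lemma
  fixes h :: "strategy \<times> strategy \<Rightarrow> real"
  assumes [measurable]: "h \<in> borel_measurable (strategy_space \<Otimes>\<^sub>M strategy_space)"
  shows integral_joint: "(\<integral>s. h (s 0, s 1) \<partial>joint I \<sigma>) = integral\<^sup>L (\<sigma> 0 \<Otimes>\<^sub>M \<sigma> 1) h"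
    and integrable_joint: "integrable (joint I \<sigma>) (\<lambda>s. h (s 0, s 1)) \<longleftrightarrow> integrable (\<sigma> 0 \<Otimes>\<^sub>M \<sigma> 1) h"
proof -
  have h: "h \<in> borel_measurable (\<sigma> 0 \<Otimes>\<^sub>M \<sigma> 1)" by measurable
  show "(\<integral>s. h (s 0, s 1) \<partial>joint I \<sigma>) = integral\<^sup>L (\<sigma> 0 \<Otimes>\<^sub>M \<sigma> 1) h"
    using integral_distr[OF measurable_joint h] by (simp only: distr_joint)
  show "integrable (joint I \<sigma>) (\<lambda>s. h (s 0, s 1)) \<longleftrightarrow> integrable (\<sigma> 0 \<Otimes>\<^sub>M \<sigma> 1) h"
    using integrable_distr_eq[OF measurable_joint h] by (simp only: distr_joint)
qed

text \<open>Once a bidder deviates to a fixed strategy, its payoff depends on the opponent alone, so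
  its expectation lives on one marginal.\<close>

lemma integral_joint_component:
  fixes h :: "strategy \<Rightarrow> real"
  assumes "i < 2" and [measurable]: "h \<in> borel_measurable strategy_space"
  shows "(\<integral>s. h (s i) \<partial>joint I \<sigma>) = integral\<^sup>L (\<sigma> i) h"
proof -
  have "(\<lambda>s. s i) \<in> joint I \<sigma> \<rightarrow>\<^sub>M \<sigma> i"
    unfolding joint_def two by (rule measurable_component_singleton) (use assms in simp)
  moreover have "h \<in> borel_measurable (\<sigma> i)"
    using assms measurable_cong_sets[OF sets_\<sigma>[of i] refl] by blast
  moreover have "distr (joint I \<sigma>) (\<sigma> i) (\<lambda>s. s i) = \<sigma> i"
    unfolding joint_def two by (rule distr_PiM_component) (use assms prob in auto)
  ultimately show ?thesis using integral_distr[of "\<lambda>s. s i" "joint I \<sigma>" "\<sigma> i" h] by simp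
qed

lemma measurable_payoff_sections [measurable]:
  "(\<lambda>y. payoff0 I x y) \<in> borel_measurable strategy_space"
  "(\<lambda>x. payoff1 I x y) \<in> borel_measurable strategy_space"
proof -
  have "(\<lambda>y. (x, y)) \<in> strategy_space \<rightarrow>\<^sub>M strategy_space \<Otimes>\<^sub>M strategy_space"
    "(\<lambda>x. (x, y)) \<in> strategy_space \<rightarrow>\<^sub>M strategy_space \<Otimes>\<^sub>M strategy_space"
    by simp_all
  from this(1)[THEN measurable_compose, OF measurable_payoff0[of I]]
    this(2)[THEN measurable_compose, OF measurable_payoff1[of I]]
  show "(\<lambda>y. payoff0 I x y) \<in> borel_measurable strategy_space"
    "(\<lambda>x. payoff1 I x y) \<in> borel_measurable strategy_space" by simp_all
qed

definition value0 :: real where "value0 = (\<integral>s. utility I 0 s \<partial>joint I \<sigma>)"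
definition value1 :: real where "value1 = (\<integral>s. utility I 1 s \<partial>joint I \<sigma>)"

end

locale two_bidder_equilibrium = two_bidder_play +
  assumes eq: "\<sigma> \<in> mixed_equilibria I"
begin

lemma AE_strategies: "AE x in \<sigma> 0. x \<in> strategies I" "AE y in \<sigma> 1. y \<in> strategies I"
  using eq two by (simp_all add: mixed_equilibria_def)

lemma deviation0:
  assumes "t \<in> strategies I"
  shows "(\<integral>y. payoff0 I t y \<partial>\<sigma> 1) \<le> value0"
proof -
  have "(\<integral>s. utility I 0 (s(0 := t)) \<partial>joint I \<sigma>) \<le> value0"
    using eq two assms by (simp add: mixed_equilibria_def value0_def)
  then show ?thesis
    using integral_joint_component[of 1 "payoff0 I t"] by (simp add: utility_two_bidders[OF two])
qed

lemma deviation1: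
  assumes "t \<in> strategies I"
  shows "(\<integral>x. payoff1 I x t \<partial>\<sigma> 0) \<le> value1"
proof -
  have "(\<integral>s. utility I 1 (s(1 := t)) \<partial>joint I \<sigma>) \<le> value1"
    using eq two assms by (simp add: mixed_equilibria_def value1_def)
  then show ?thesis
    using integral_joint_component[of 0 "\<lambda>x. payoff1 I x t"]
      utility_two_bidders(2)[OF two] by simp
qed

text \<open>Almost every strategy of bidder 0 is an admissible deviation, so none of these earns
  more than \<open>value0\<close>; by Fubini their average is \<open>value0\<close>, so almost all
  attain it.\<close>

lemma AE_best_response0: "AE x in \<sigma> 0. (\<integral>y. payoff0 I x y \<partial>\<sigma> 1) = value0"
proof -
  let ?h = "\<lambda>p. payoff0 I (fst p) (snd p)"
  have "integrable (joint I \<sigma>) (utility I 0)"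
    using eq two by (simp add: mixed_equilibria_def)
  then have int: "integrable (\<sigma> 0 \<Otimes>\<^sub>M \<sigma> 1) ?h"
    using integrable_joint[of ?h] by (simp add: utility_two_bidders[OF two] cong: Bochner_Integration.integrable_cong)
  have "value0 = (\<integral>x. \<integral>y. payoff0 I x y \<partial>\<sigma> 1 \<partial>\<sigma> 0)"
    using integral_joint[of ?h] P.integral_fst'[OF int]
    by (simp add: value0_def utility_two_bidders[OF two])
  moreover have "AE x in \<sigma> 0. (\<integral>y. payoff0 I x y \<partial>\<sigma> 1) \<le> value0"
    using AE_strategies(1) by eventually_elim (rule deviation0)
  ultimately show ?thesis
    using P0.AE_eq_of_AE_le_integral[of "\<lambda>x. \<integral>y. payoff0 I x y \<partial>\<sigma> 1"] P.integrable_fst'[OF int]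
    by simp
qed

lemma AE_best_response1: "AE y in \<sigma> 1. (\<integral>x. payoff1 I x y \<partial>\<sigma> 0) = value1"
proof -
  let ?h = "\<lambda>p. payoff1 I (fst p) (snd p)"
  have "integrable (joint I \<sigma>) (utility I 1)"
    using eq two by (simp add: mixed_equilibria_def)
  then have int: "integrable (\<sigma> 0 \<Otimes>\<^sub>M \<sigma> 1) ?h"
    using integrable_joint[of ?h] utility_two_bidders(2)[OF two] by (simp cong: Bochner_Integration.integrable_cong)
  then have int': "integrable (\<sigma> 0 \<Otimes>\<^sub>M \<sigma> 1) (case_prod (payoff1 I))"
    by (simp add: case_prod_beta')
  have "value1 = (\<integral>y. \<integral>x. payoff1 I x y \<partial>\<sigma> 0 \<partial>\<sigma> 1)"
    using integral_joint[of ?h] P.integral_snd[OF int'] utility_two_bidders(2)[OF two]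
    by (simp add: value1_def case_prod_beta')
  moreover have "AE y in \<sigma> 1. (\<integral>x. payoff1 I x y \<partial>\<sigma> 0) \<le> value1"
    using AE_strategies(2) by eventually_elim (rule deviation1)
  ultimately show ?thesis
    using P1.AE_eq_of_AE_le_integral[of "\<lambda>y. \<integral>x. payoff1 I x y \<partial>\<sigma> 0"] P.integrable_snd[OF int']
    by simp
qed

end

text \<open>Point masses make the strategies almost surely constant, so every expectation is the
  corresponding pure quantity. Bounds on mixed equilibria thereby cover pure ones.\<close>

lemma pure_equilibrium_imp_mixed:
  assumes two: "bidders I = 2" and s: "s \<in> pure_equilibria I"
  shows "(\<lambda>i. return strategy_space (s i)) \<in> mixed_equilibria I"
    and "(\<integral>r. welfare I (outcome I r) \<partial>joint I (\<lambda>i. return strategy_space (s i))) =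
      welfare I (outcome I s)"
proof -
  let ?\<sigma> = "\<lambda>i. return strategy_space (s i)"
  have singleton: "{x} \<in> sets strategy_space" for x
  proof -
    have "{fst x} \<times> {snd x} \<in> sets strategy_space"
      unfolding strategy_space_def by (rule pair_measureI) auto
    then show ?thesis by simp
  qed
  \<comment> \<open>Only the product structure is available: that the point masses form an
    equilibrium is still to be shown.\<close>
  interpret two_bidder_play I ?\<sigma>
    by (rule two_bidder_play.intro) (simp_all add: two prob_space_return)
  have AE_\<sigma>: "AE x in ?\<sigma> i. x = s i" for i
    using singleton[of "s i"] by (subst AE_return) (auto simp: pred_def)
  have AE_joint: "AE r in joint I ?\<sigma>. r i = s i" if "i < 2" for i
    unfolding joint_def two
    by (rule AE_PiM_component[where P="\<lambda>x. x = s i"]) (use that prob AE_\<sigma> in auto)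
  interpret J: prob_space "joint I ?\<sigma>"
    unfolding joint_def two by (rule prob_space_PiM) (use prob in auto)
  have dirac: "integrable (joint I ?\<sigma>) (\<lambda>r. h (r 0, r 1))"
    "(\<integral>r. h (r 0, r 1) \<partial>joint I ?\<sigma>) = h (s 0, s 1)"
    if [measurable]: "h \<in> borel_measurable (strategy_space \<Otimes>\<^sub>M strategy_space)"
    for h :: "strategy \<times> strategy \<Rightarrow> real"
  proof -
    have h: "h \<in> borel_measurable (?\<sigma> 0 \<Otimes>\<^sub>M ?\<sigma> 1)" by measurable
    have meas: "(\<lambda>r. h (r 0, r 1)) \<in> borel_measurable (joint I ?\<sigma>)"
      using measurable_compose[OF measurable_joint h] .
    have AE: "AE r in joint I ?\<sigma>. h (r 0, r 1) = h (s 0, s 1)"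
      using AE_joint[of 0] AE_joint[of 1] by (auto elim: eventually_elim2)
    show "integrable (joint I ?\<sigma>) (\<lambda>r. h (r 0, r 1))"
      by (rule integrable_cong_AE_imp[of _ "\<lambda>_. h (s 0, s 1)"]) (use meas AE in auto)
    have "(\<integral>r. h (r 0, r 1) \<partial>joint I ?\<sigma>) = (\<integral>r. h (s 0, s 1) \<partial>joint I ?\<sigma>)"
      by (rule integral_cong_AE) (use meas AE in auto)
    then show "(\<integral>r. h (r 0, r 1) \<partial>joint I ?\<sigma>) = h (s 0, s 1)"
      by (simp add: J.prob_space)
  qed
  have u0: "utility I 0 = (\<lambda>r. payoff0 I (r 0) (r 1))" and u1: "utility I 1 = (\<lambda>r. payoff1 I (r 0) (r 1))"
    using utility_two_bidders[OF two] by auto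
  have utility: "integrable (joint I ?\<sigma>) (utility I i)"
    "(\<integral>r. utility I i r \<partial>joint I ?\<sigma>) = utility I i s"
    "(\<integral>r. utility I i (r(i := t)) \<partial>joint I ?\<sigma>) = utility I i (s(i := t))" if i: "i < 2" for i t
  proof -
    consider "i = 0" | "i = 1" using i by linarith
    then have "integrable (joint I ?\<sigma>) (utility I i) \<and>
      (\<integral>r. utility I i r \<partial>joint I ?\<sigma>) = utility I i s \<and>
      (\<integral>r. utility I i (r(i := t)) \<partial>joint I ?\<sigma>) = utility I i (s(i := t))"
    proof cases
      case 1
      then show ?thesis
        using dirac[of "\<lambda>p. payoff0 I (fst p) (snd p)"] dirac[of "\<lambda>p. payoff0 I t (snd p)"]
        by (simp add: u0)
    next
      case 2
      then show ?thesis
        using dirac[of "\<lambda>p. payoff1 I (fst p) (snd p)"] dirac[of "\<lambda>p. payoff1 I (fst p) t"] u1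
        by simp
    qed
    then show "integrable (joint I ?\<sigma>) (utility I i)"
      "(\<integral>r. utility I i r \<partial>joint I ?\<sigma>) = utility I i s"
      "(\<integral>r. utility I i (r(i := t)) \<partial>joint I ?\<sigma>) = utility I i (s(i := t))" by simp_all
  qed
  have "AE x in ?\<sigma> i. x \<in> strategies I" if "i < 2" for i
    using AE_\<sigma>[of i] by eventually_elim (use s that two in \<open>simp add: pure_equilibria_def\<close>)
  then show "?\<sigma> \<in> mixed_equilibria I"
    using s prob utility by (simp add: mixed_equilibria_def pure_equilibria_def two)
  show "(\<integral>r. welfare I (outcome I r) \<partial>joint I ?\<sigma>) = welfare I (outcome I s)"
    using dirac(2)[OF measurable_welfare_two_bidders[of I]] by (simp add: welfare_two_bidders[OF two])
qed

section \<open>A bidder for all items against a unit-demand bidder\<close>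

text \<open>\<open>\<beta>\<close> is what the full bundle is worth per item to bidder 1; below 1,
  it leaves bidder 0 a gain of \<open>1 - \<beta>\<close> from one item at that price.\<close>

locale bundle_vs_single =
  fixes d :: nat and \<beta> :: real
  assumes \<beta>: "0 < \<beta>" "\<beta> < 1"
begin

abbreviation J :: "nat set" where "J \<equiv> {..<Suc d}"

abbreviation V :: real where "V \<equiv> real (Suc d) * \<beta>"

definition inst :: auction where
  "inst = \<lparr>bidders = 2, items = Suc d,
     val = (\<lambda>i S. if i = 0 then (if S = {} then 0 else 1) else (if J \<subseteq> S then V else 0))\<rparr>"

lemma inst_simps [simp]:
  "bidders inst = 2" "items inst = Suc d"
  "val inst 0 = (\<lambda>S. if S = {} then 0 else 1)"
  "val inst (Suc 0) = (\<lambda>S. if J \<subseteq> S then V else 0)"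
  by (simp_all add: inst_def)

lemma J_nonempty [simp]: "J \<noteq> {}" by (simp add: lessThan_Suc)

lemma V_pos: "0 < V" using \<beta> by simp

lemma strategyD:
  assumes "x \<in> strategies inst"
  shows "0 \<le> fst x" and "A \<subseteq> J \<Longrightarrow> snd x A \<subseteq> A"
  using assms by (cases x; simp add: strategies_def)+

lemma bundle0_subset: "x \<in> strategies inst \<Longrightarrow> bundle0 inst x y \<subseteq> J"
  using strategyD(2)[of x J] strategyD(2)[of x "J - snd y J"] by (auto simp: bundle0_def)

lemma bundle1_subset: "y \<in> strategies inst \<Longrightarrow> bundle1 inst x y \<subseteq> J"
  using strategyD(2)[of y J] strategyD(2)[of y "J - snd x J"] by (auto simp: bundle1_def)

text \<open>Bidder 0 goes first, also at equal bids, and takes at least one item, which is then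
  missing from what bidder 1 is offered.\<close>

lemma bundle1_not_all:
  assumes "x \<in> strategies inst" "y \<in> strategies inst" "fst y \<le> fst x" "snd x J \<noteq> {}"
  shows "\<not> J \<subseteq> bundle1 inst x y"
  using strategyD(2)[OF assms(1), of J] strategyD(2)[OF assms(2), of "J - snd x J"] assms(3,4)
  by (auto simp: bundle1_def)

lemma card_bundle_le:
  assumes "A \<subseteq> J"
  shows "real (card A) \<le> real (Suc d)"
  using card_mono[OF _ assms] by simp

lemma payoff0_le: "x \<in> strategies inst \<Longrightarrow> payoff0 inst x y \<le> 1"
  using strategyD(1)[of x] by (simp add: payoff0_def)

lemma payoff1_le: "y \<in> strategies inst \<Longrightarrow> payoff1 inst x y \<le> V"
  using mult_nonneg_nonneg[OF strategyD(1), of y "real (card (bundle1 inst x y))"] V_pos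
  by (simp add: payoff1_def del: of_nat_Suc)

text \<open>With \<open>payoff0_le\<close> this bounds the payoff uniformly in the opponent's
  strategy; the own bid is fixed when the sections are integrated.\<close>

lemma payoff0_ge:
  assumes "x \<in> strategies inst"
  shows "- (fst x * real (Suc d)) \<le> payoff0 inst x y"
proof -
  have "fst x * real (card (bundle0 inst x y)) \<le> fst x * real (Suc d)"
    using card_bundle_le[OF bundle0_subset[OF assms]] strategyD(1)[OF assms] by (rule mult_left_mono)
  then show ?thesis using strategyD(1)[OF assms] by (simp add: payoff0_def del: of_nat_Suc)
qed

lemma payoff1_ge:
  assumes "y \<in> strategies inst"
  shows "- (fst y * real (Suc d)) \<le> payoff1 inst x y"
proof -
  have "fst y * real (card (bundle1 inst x y)) \<le> fst y * real (Suc d)"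
    using card_bundle_le[OF bundle1_subset[OF assms]] strategyD(1)[OF assms] by (rule mult_left_mono)
  then show ?thesis using V_pos by (simp add: payoff1_def del: of_nat_Suc)
qed

lemma payoff1_nonpos_of_not_all:
  assumes "y \<in> strategies inst" "\<not> J \<subseteq> bundle1 inst x y"
  shows "payoff1 inst x y \<le> 0"
  using strategyD(1)[OF assms(1)] assms(2) by (simp add: payoff1_def)

text \<open>The full bundle yields \<open>real (Suc d) * (\<beta> - fst y)\<close>; any other bundle
  is worthless and has a nonnegative price.\<close>

lemma payoff1_nonpos_of_bid:
  assumes "y \<in> strategies inst" "\<beta> \<le> fst y"
  shows "payoff1 inst x y \<le> 0"
proof (cases "J \<subseteq> bundle1 inst x y")
  case True
  then have "bundle1 inst x y = J" using bundle1_subset[OF assms(1), of x] by auto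
  then have "payoff1 inst x y = real (Suc d) * (\<beta> - fst y)"
    by (simp add: payoff1_def algebra_simps)
  also have "\<dots> \<le> 0" using assms by (intro mult_nonneg_nonpos) auto
  finally show ?thesis .
qed (use payoff1_nonpos_of_not_all assms in blast)

text \<open>The loss is strict: the full bundle costs more than its value, and a partial nonempty
  one has value 0 at a positive price.\<close>

lemma payoff1_neg:
  assumes "y \<in> strategies inst" "\<beta> < fst y" "bundle1 inst x y \<noteq> {}"
  shows "payoff1 inst x y < 0"
proof (cases "J \<subseteq> bundle1 inst x y")
  case True
  then have "bundle1 inst x y = J" using bundle1_subset[OF assms(1), of x] by auto
  then have "payoff1 inst x y = real (Suc d) * (\<beta> - fst y)"
    by (simp add: payoff1_def algebra_simps)
  also have "\<dots> < 0" using assms by (intro mult_pos_neg) auto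
  finally show ?thesis .
next
  case False
  have "0 < card (bundle1 inst x y)"
    using assms bundle1_subset[OF assms(1), of x] by (simp add: card_gt_0_iff finite_subset)
  then show ?thesis using False assms \<beta> by (simp add: payoff1_def)
qed

lemma valuations: "i < bidders inst \<Longrightarrow> val inst i \<in> SAW_class {..<items inst} d"
  using SAW_le_card_pred[of J "val inst i"] \<beta>
  by (auto simp: SAW_class_def valuation_def inst_def)

lemma optimal_welfare_ge: "V \<le> optimal_welfare inst"
proof -
  let ?X = "\<lambda>i::nat. if i = 1 then J else {}"
  have "?X \<in> allocations inst"
    by (auto simp: allocations_def disjoint_family_on_def)
  moreover have "welfare inst ?X = V"
    by (simp add: welfare_def numeral_2_eq_2)
  moreover have "bdd_above (welfare inst ` allocations inst)"
    by (rule bdd_aboveI[of _ "1 + V"])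
      (use \<beta> in \<open>auto simp: welfare_def numeral_2_eq_2 simp del: of_nat_Suc\<close>)
  ultimately show ?thesis
    unfolding optimal_welfare_def by (metis cSUP_upper)
qed

text \<open>The tie at \<open>\<beta>\<close> lets bidder 0 take an item first. Bidder 1's
  all-or-nothing rule is a threat: against a lower bid it would take everything, so bidder 0 cannot
  gain by lowering its bid.\<close>

definition eq_profile :: "nat \<Rightarrow> strategy" where
  "eq_profile i = (\<beta>, \<lambda>A. if i = 0 then A \<inter> {0} else if A = J then J else {})"

lemma eq_profile_strategies: "eq_profile i \<in> strategies inst"
  using \<beta> by (auto simp: eq_profile_def strategies_def)

lemma bundles_eq_profile:
  "bundle0 inst (eq_profile 0) (eq_profile 1) = {0}"
  "bundle1 inst (eq_profile 0) (eq_profile 1) = {}"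
  by (auto simp: bundle0_def bundle1_def eq_profile_def)

lemma eq_profile_equilibrium: "eq_profile \<in> pure_equilibria inst"
proof -
  have "payoff0 inst t (eq_profile 1) \<le> payoff0 inst (eq_profile 0) (eq_profile 1)"
    if t: "t \<in> strategies inst" for t
  proof -
    have "payoff0 inst (eq_profile 0) (eq_profile 1) = 1 - \<beta>"
      unfolding payoff0_def bundles_eq_profile by (simp add: eq_profile_def)
    moreover have "payoff0 inst t (eq_profile 1) \<le> 1 - \<beta>"
    proof (cases "bundle0 inst t (eq_profile 1) = {}")
      case True
      then show ?thesis using \<beta> by (simp add: payoff0_def)
    next
      case False
      \<comment> \<open>Below \<open>\<beta>\<close>, bidder 0 comes second and finds nothing left,
        so a nonempty bundle costs at least \<open>\<beta>\<close>.\<close>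
      have "\<beta> \<le> fst t"
      proof (rule ccontr)
        assume "\<not> \<beta> \<le> fst t"
        then have "bundle0 inst t (eq_profile 1) = snd t {}"
          by (simp add: bundle0_def eq_profile_def)
        with False strategyD(2)[OF t, of "{}"] show False by simp
      qed
      moreover have "1 \<le> card (bundle0 inst t (eq_profile 1))"
        using False finite_subset[OF bundle0_subset[OF t]] by (simp add: Suc_le_eq card_gt_0_iff)
      then have "fst t * 1 \<le> fst t * real (card (bundle0 inst t (eq_profile 1)))"
        using strategyD(1)[OF t] by (intro mult_left_mono) auto
      ultimately show ?thesis using False by (simp add: payoff0_def)
    qed
    ultimately show ?thesis by simp
  qed
  moreover have "payoff1 inst (eq_profile 0) t \<le> payoff1 inst (eq_profile 0) (eq_profile 1)"
    if t: "t \<in> strategies inst" for t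
  proof -
    have "payoff1 inst (eq_profile 0) (eq_profile 1) = 0"
      unfolding payoff1_def bundles_eq_profile by simp
    \<comment> \<open>A bid of at least \<open>\<beta>\<close> never profits; a lower one comes
      after bidder 0 has taken item 0.\<close>
    moreover have "payoff1 inst (eq_profile 0) t \<le> 0"
    proof (cases "\<beta> \<le> fst t")
      case False
      then have "\<not> J \<subseteq> bundle1 inst (eq_profile 0) t"
        by (intro bundle1_not_all eq_profile_strategies t) (auto simp: eq_profile_def)
      with t show ?thesis by (rule payoff1_nonpos_of_not_all)
    qed (use t payoff1_nonpos_of_bid in blast)
    ultimately show ?thesis by simp
  qed
  ultimately show ?thesis
    using eq_profile_strategies utility_two_bidders[of inst]
    by (auto simp: pure_equilibria_def less_2_cases_iff)
qed

lemma welfare_eq_profile: "welfare inst (outcome inst eq_profile) = 1"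
  using bundles_eq_profile by (simp add: welfare_two_bidders)

end

section \<open>Mixed equilibria of the instance\<close>

locale bundle_vs_single_equilibrium =
  bundle_vs_single d \<beta> + two_bidder_equilibrium inst \<sigma>
  for d :: nat and \<beta> :: real and \<sigma> :: "nat \<Rightarrow> strategy measure"
begin

lemma integrable_payoff0:
  assumes "x \<in> strategies inst"
  shows "integrable (\<sigma> 1) (\<lambda>y. payoff0 inst x y)"
proof (rule P1.integrable_const_bound[OF AE_I2])
  show "norm (payoff0 inst x y) \<le> 1 + fst x * real (Suc d)" for y
    using payoff0_le[OF assms, of y] payoff0_ge[OF assms, of y]
      mult_nonneg_nonneg[OF strategyD(1)[OF assms], of "real (Suc d)"]
    by (simp add: abs_le_iff del: of_nat_Suc)
qed simp

lemma integrable_payoff1: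
  assumes "y \<in> strategies inst"
  shows "integrable (\<sigma> 0) (\<lambda>x. payoff1 inst x y)"
proof (rule P0.integrable_const_bound[OF AE_I2])
  show "norm (payoff1 inst x y) \<le> V + fst y * real (Suc d)" for x
    using payoff1_le[OF assms, of x] payoff1_ge[OF assms, of x] V_pos
      mult_nonneg_nonneg[OF strategyD(1)[OF assms], of "real (Suc d)"]
    by (simp add: abs_le_iff del: of_nat_Suc)
qed simp

lemma value1_nonneg: "0 \<le> value1"
proof -
  have "payoff1 inst x (0, \<lambda>_. {}) = 0" for x
    by (simp add: payoff1_def bundle1_def)
  then show ?thesis using deviation1[of "(0, \<lambda>_. {})"] by (simp add: strategies_def)
qed

text \<open>A bid above \<open>\<beta>\<close> never earns more than 0, which is at most
  \<open>value1\<close>; being a best response, it must almost surely earn exactly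
  \<open>value1\<close>. Any nonempty bundle would earn less than 0.\<close>

lemma AE_overbidder_takes_nothing:
  "AE y in \<sigma> 1. \<beta> < fst y \<longrightarrow> (AE x in \<sigma> 0. bundle1 inst x y = {})"
  using AE_strategies(2) AE_best_response1
proof eventually_elim
  case (elim y)
  show ?case
  proof
    assume y: "\<beta> < fst y"
    have "AE x in \<sigma> 0. payoff1 inst x y = (\<integral>x. payoff1 inst x y \<partial>\<sigma> 0)"
    proof (rule P0.AE_eq_of_AE_le_integral[OF integrable_payoff1[OF elim(1)]])
      show "AE x in \<sigma> 0. payoff1 inst x y \<le> (\<integral>x. payoff1 inst x y \<partial>\<sigma> 0)"
        unfolding elim(2) using payoff1_nonpos_of_bid[OF elim(1)] y value1_nonneg
        by (intro AE_I2) (meson less_imp_le order_trans)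
    qed
    then show "AE x in \<sigma> 0. bundle1 inst x y = {}"
      unfolding elim(2)
    proof eventually_elim
      case (elim x)
      then show ?case
        using payoff1_neg[OF \<open>y \<in> strategies inst\<close> y, of x] value1_nonneg by force
    qed
  qed
qed

text \<open>If bidder 1 cannot expect a profit, then no deviation to a bid \<open>z\<close> below
  \<open>\<beta>\<close> may win all items with positive probability. This forces bidder 0 to bid at
  least every such \<open>z\<close> and to take an item.\<close>

lemma AE_single_blocks:
  assumes "value1 = 0"
  shows "AE x in \<sigma> 0. \<beta> \<le> fst x \<and> snd x J \<noteq> {}"
proof -
  have "AE x in \<sigma> 0. z \<le> fst x \<and> snd x J \<noteq> {}" if z: "0 \<le> z" "z < \<beta>" for z
  proof -
    \<comment> \<open>All-or-nothing keeps the payoff nonnegative, as no partial bundle is paid for.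
      A mean of at most 0 then forces payoff 0 almost surely.\<close>
    let ?t = "(z, \<lambda>A. if A = J then J else {}) :: strategy"
    have t: "?t \<in> strategies inst" using z by (auto simp: strategies_def)
    have grab: "payoff1 inst x ?t = real (Suc d) * (\<beta> - z)" if "fst x < z \<or> snd x J = {}" for x
      using that by (auto simp: payoff1_def bundle1_def algebra_simps)
    have "0 \<le> payoff1 inst x ?t" for x
    proof (cases "bundle1 inst x ?t = {}")
      case True
      then show ?thesis by (simp add: payoff1_def)
    next
      case False
      then have "bundle1 inst x ?t = J" by (auto simp: bundle1_def split: if_splits)
      then have "payoff1 inst x ?t = real (Suc d) * (\<beta> - z)"
        by (simp add: payoff1_def algebra_simps)
      then show ?thesis using z by simp
    qed
    moreover from this have "(\<integral>x. payoff1 inst x ?t \<partial>\<sigma> 0) = 0"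
      using deviation1[OF t] assms by (intro antisym integral_nonneg) auto
    ultimately have "AE x in \<sigma> 0. payoff1 inst x ?t = 0"
      using integral_nonneg_eq_0_iff_AE[OF integrable_payoff1[OF t]] by simp
    then show ?thesis
    proof eventually_elim
      case (elim x)
      with grab[of x] z show ?case by (cases "fst x < z \<or> snd x J = {}") (auto simp del: of_nat_Suc)
    qed
  qed
  \<comment> \<open>The exceptional null set depends on \<open>z\<close>; restricting to rational
    \<open>z\<close> leaves countably many, and their density suffices to reach
    \<open>\<beta>\<close>.\<close>
  then have "AE x in \<sigma> 0. \<forall>z\<in>{z\<in>\<rat>. 0 \<le> z \<and> z < \<beta>}. z \<le> fst x \<and> snd x J \<noteq> {}"
    by (subst AE_ball_countable) (auto intro: countable_subset[OF _ countable_rat])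
  then show ?thesis
  proof eventually_elim
    case (elim x)
    have "\<beta> \<le> fst x"
    proof (rule ccontr)
      assume "\<not> \<beta> \<le> fst x"
      then obtain z where "z \<in> \<rat>" "max 0 (fst x) < z" "z < \<beta>"
        using Rats_dense_in_real[of "max 0 (fst x)" \<beta>] \<beta> by auto
      with elim show False by force
    qed
    moreover have "snd x J \<noteq> {}" using elim \<beta> by force
    ultimately show ?case ..
  qed
qed

lemma value1_not_pos: "\<not> 0 < value1"
proof
  assume pos: "0 < value1"
  have y: "AE y in \<sigma> 1. y \<in> strategies inst \<and> fst y < \<beta> \<and> snd y J = J"
    using AE_strategies(2) AE_best_response1
  proof eventually_elim
    case (elim y)
    \<comment> \<open>A strategy that is never profitable cannot have mean
      \<open>value1 > 0\<close>; this rules out bids from \<open>\<beta>\<close> up and rules that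
      decline part of \<open>J\<close>.\<close>
    have not_nonpos: "\<not> (\<forall>x. payoff1 inst x y \<le> 0)"
    proof
      assume "\<forall>x. payoff1 inst x y \<le> 0"
      then have "(\<integral>x. payoff1 inst x y \<partial>\<sigma> 0) \<le> 0"
        using integrable_payoff1[OF elim(1)] by (intro P0.integral_le_const) auto
      with elim pos show False by simp
    qed
    then have "fst y < \<beta>" using payoff1_nonpos_of_bid[OF elim(1)] by force
    moreover have "snd y J = J"
    proof (rule ccontr)
      assume "snd y J \<noteq> J"
      then have "\<not> J \<subseteq> bundle1 inst x y" for x
        using strategyD(2)[OF elim(1), of J] strategyD(2)[OF elim(1), of "J - snd x J"]
        by (cases "J - snd x J = J") (auto simp: bundle1_def)
      with payoff1_nonpos_of_not_all[OF elim(1)] not_nonpos show False by blast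
    qed
    ultimately show ?case using elim by simp
  qed
  \<comment> \<open>Bidding \<open>\<beta>\<close> beats almost every bid of bidder 1 and buys item
    0 for a gain of \<open>1 - \<beta>\<close>.\<close>
  have "1 - \<beta> \<le> value0"
  proof -
    have "AE y in \<sigma> 1. payoff0 inst (eq_profile 0) y = 1 - \<beta>"
      using y by eventually_elim (simp add: payoff0_def bundle0_def eq_profile_def Int_insert_right)
    then have "(\<integral>y. payoff0 inst (eq_profile 0) y \<partial>\<sigma> 1) = (\<integral>y. 1 - \<beta> \<partial>\<sigma> 1)"
      by (intro integral_cong_AE) auto
    then show ?thesis
      using deviation0[OF eq_profile_strategies[of 0]] P1.prob_space by simp
  qed
  have x: "AE x in \<sigma> 0. x \<in> strategies inst \<and> snd x J \<noteq> {} \<and>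
      1 - \<beta> \<le> measure (\<sigma> 1) {y \<in> space (\<sigma> 1). fst y \<le> fst x}"
    using AE_strategies(1) AE_best_response0
  proof eventually_elim
    case (elim x)
    \<comment> \<open>Coming second, bidder 0 faces an empty set, since bidder 1 has taken all of
      \<open>J\<close>.\<close>
    have last: "payoff0 inst x y = 0" if "snd y J = J" "fst x < fst y" for y
      using that strategyD(2)[OF elim(1), of "{}"] by (simp add: payoff0_def bundle0_def)
    have "snd x J \<noteq> {}"
    proof
      assume "snd x J = {}"
      have "AE y in \<sigma> 1. payoff0 inst x y \<le> 0"
        using y
      proof eventually_elim
        case (elim y)
        with last[of y] \<open>snd x J = {}\<close> show ?case
          by (cases "fst y \<le> fst x") (auto simp: payoff0_def bundle0_def)
      qed
      then have "(\<integral>y. payoff0 inst x y \<partial>\<sigma> 1) \<le> 0"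
        using integrable_payoff0[OF elim(1)] by (intro P1.integral_le_const)
      with elim \<open>1 - \<beta> \<le> value0\<close> \<beta> show False by simp
    qed
    moreover have "1 - \<beta> \<le> measure (\<sigma> 1) {y \<in> space (\<sigma> 1). fst y \<le> fst x}"
    proof -
      \<comment> \<open>Bidder 0 earns at most 1, and only when it comes first, so its mean is at
        most the probability of coming first.\<close>
      have "AE y in \<sigma> 1. payoff0 inst x y \<le> indicator {y \<in> space (\<sigma> 1). fst y \<le> fst x} y"
        using y
      proof eventually_elim
        case (elim y)
        with last[of y] payoff0_le[OF \<open>x \<in> strategies inst\<close>, of y] show ?case
          by (cases "fst y \<le> fst x") auto
      qed
      moreover have "{y \<in> space (\<sigma> 1). fst y \<le> fst x} \<in> sets (\<sigma> 1)" by measurable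
      then have "integrable (\<sigma> 1) (indicator {y \<in> space (\<sigma> 1). fst y \<le> fst x} :: strategy \<Rightarrow> real)"
        by (rule integrable_real_indicator) (simp only: P1.emeasure_eq_measure ennreal_less_top infinity_ennreal_def)
      ultimately have "(\<integral>y. payoff0 inst x y \<partial>\<sigma> 1) \<le>
          (\<integral>y. indicator {y \<in> space (\<sigma> 1). fst y \<le> fst x} y \<partial>\<sigma> 1)"
        using integrable_payoff0[OF elim(1)] by (intro integral_mono_AE)
      with elim \<open>1 - \<beta> \<le> value0\<close> show ?thesis by simp
    qed
    ultimately show ?case using elim by simp
  qed
  have "AE y in \<sigma> 1. value1 / V \<le> measure (\<sigma> 0) {x \<in> space (\<sigma> 0). fst x < fst y}"
    using y AE_best_response1
  proof eventually_elim
    case (elim y)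
    \<comment> \<open>Bidder 1 profits only when strictly outbidding bidder 0, since ties favour
      bidder 0, and then by at most \<open>V\<close>.\<close>
    have "AE x in \<sigma> 0. payoff1 inst x y \<le> V * indicator {x \<in> space (\<sigma> 0). fst x < fst y} x"
      using x
    proof eventually_elim
      case (elim x)
      with \<open>y \<in> strategies inst \<and> fst y < \<beta> \<and> snd y J = J\<close>
        bundle1_not_all[of x y] payoff1_nonpos_of_not_all[of y x] payoff1_le[of y x]
      show ?case by (cases "fst x < fst y") auto
    qed
    moreover have "{x \<in> space (\<sigma> 0). fst x < fst y} \<in> sets (\<sigma> 0)" by measurable
    then have "integrable (\<sigma> 0) (indicator {x \<in> space (\<sigma> 0). fst x < fst y} :: strategy \<Rightarrow> real)"
      by (rule integrable_real_indicator)
        (simp only: P0.emeasure_eq_measure ennreal_less_top infinity_ennreal_def)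
    then have "integrable (\<sigma> 0) (\<lambda>x. V * indicator {x \<in> space (\<sigma> 0). fst x < fst y} x)"
      by (rule integrable_mult_right)
    ultimately have "(\<integral>x. payoff1 inst x y \<partial>\<sigma> 0) \<le>
        (\<integral>x. V * indicator {x \<in> space (\<sigma> 0). fst x < fst y} x \<partial>\<sigma> 0)"
      using integrable_payoff1[of y] elim by (intro integral_mono_AE) blast+
    with elim V_pos show ?case by (simp add: divide_le_eq mult.commute del: of_nat_Suc)
  qed
  moreover have "AE x in \<sigma> 0. 1 - \<beta> \<le> measure (\<sigma> 1) {y \<in> space (\<sigma> 1). fst y \<le> fst x}"
    using x by eventually_elim simp
  ultimately show False
    using no_mutual_undercutting[of "\<sigma> 0" "\<sigma> 1" fst fst "1 - \<beta>" "value1 / V"]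
      P0.prob_space_axioms P1.prob_space_axioms \<beta> pos V_pos by simp
qed

text \<open>Bids above \<open>\<beta>\<close> take nothing; bids up to \<open>\<beta>\<close> come
  after bidder 0, which by \<open>value1 = 0\<close> almost surely bids at least
  \<open>\<beta>\<close> and takes an item.\<close>

lemma AE_bundle_not_sold: "AE y in \<sigma> 1. AE x in \<sigma> 0. \<not> J \<subseteq> bundle1 inst x y"
  using AE_strategies(2) AE_overbidder_takes_nothing
proof eventually_elim
  case (elim y)
  show ?case
  proof (cases "\<beta> < fst y")
    case True
    with elim have "AE x in \<sigma> 0. bundle1 inst x y = {}" by simp
    then show ?thesis by eventually_elim auto
  next
    case False
    have "value1 = 0" using value1_nonneg value1_not_pos by simp
    from AE_single_blocks[OF this] AE_strategies(1) show ?thesis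
      by eventually_elim (use False bundle1_not_all[OF _ elim(1)] in auto)
  qed
qed

lemma expected_welfare_le_1: "(\<integral>s. welfare inst (outcome inst s) \<partial>joint inst \<sigma>) \<le> 1"
proof -
  let ?h = "\<lambda>x y. val inst 0 (bundle0 inst x y) + val inst 1 (bundle1 inst x y)"
  have meas: "(\<lambda>p. ?h (fst p) (snd p)) \<in> borel_measurable (\<sigma> 0 \<Otimes>\<^sub>M \<sigma> 1)"
    using measurable_welfare_two_bidders[of inst] by measurable
  have "norm (?h x y) \<le> 1 + V" for x y
    using V_pos by (auto simp del: of_nat_Suc)
  then have int: "integrable (\<sigma> 0 \<Otimes>\<^sub>M \<sigma> 1) (case_prod ?h)"
    using meas by (intro P.integrable_const_bound[of _ "1 + V"]) (auto simp: case_prod_beta' simp del: inst_simps(3,4))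
  have inner: "AE y in \<sigma> 1. (\<integral>x. ?h x y \<partial>\<sigma> 0) \<le> 1"
    using AE_bundle_not_sold P.AE_integrable_snd[OF int]
  proof eventually_elim
    case (elim y)
    \<comment> \<open>Without the full bundle bidder 1 contributes 0, leaving bidder 0's value of at
      most 1.\<close>
    have "AE x in \<sigma> 0. ?h x y \<le> 1" using elim(1) by eventually_elim simp
    with elim(2) show ?case by (intro P0.integral_le_const) auto
  qed
  have "(\<integral>s. welfare inst (outcome inst s) \<partial>joint inst \<sigma>) = (\<integral>p. ?h (fst p) (snd p) \<partial>(\<sigma> 0 \<Otimes>\<^sub>M \<sigma> 1))"
    using integral_joint[OF measurable_welfare_two_bidders[of inst]]
    by (simp only: welfare_two_bidders[OF inst_simps(1)] fst_conv snd_conv)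
  also have "\<dots> = (\<integral>y. \<integral>x. ?h x y \<partial>\<sigma> 0 \<partial>\<sigma> 1)"
    using P.integral_snd[OF int] by (simp only: case_prod_beta')
  also have "\<dots> \<le> 1"
    using P.integrable_snd[OF int] inner by (rule P1.integral_le_const)
  finally show ?thesis .
qed

end

section \<open>Price of stability of the instance\<close>

context bundle_vs_single
begin

lemma mixed_welfare_le_1:
  assumes "\<sigma> \<in> mixed_equilibria inst"
  shows "(\<integral>s. welfare inst (outcome inst s) \<partial>joint inst \<sigma>) \<le> 1"
proof -
  interpret bundle_vs_single_equilibrium d \<beta> \<sigma>
    using assms
    by (intro bundle_vs_single_equilibrium.intro two_bidder_equilibrium.intro two_bidder_play.intro
        two_bidder_equilibrium_axioms.intro bundle_vs_single_axioms)
      (auto simp: mixed_equilibria_def)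
  show ?thesis by (rule expected_welfare_le_1)
qed

text \<open>An arbitrary family \<open>E\<close> serves pure and mixed equilibria alike. The element
  \<open>e\<close> of welfare 1 makes the supremum exactly 1, so the ratio is the optimal welfare
  itself.\<close>

lemma optimal_welfare_ratio_ge:
  fixes w :: "'s \<Rightarrow> real"
  assumes "e \<in> E" "w e = 1" "\<And>s. s \<in> E \<Longrightarrow> w s \<le> 1"
  shows "V \<le> optimal_welfare inst / (SUP s\<in>E. w s)"
proof -
  have "(SUP s\<in>E. w s) = 1"
    using assms by (intro cSup_eq_maximum) force+
  then show ?thesis using optimal_welfare_ge by simp
qed

lemma price_of_stability_ge:
  shows "V \<le> pure_price_of_stability inst" and "V \<le> mixed_price_of_stability inst"
proof -
  \<comment> \<open>The bound for a pure equilibrium is the mixed bound at its point masses;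
    \<open>eq_profile\<close> attains it.\<close>
  show "V \<le> pure_price_of_stability inst"
    unfolding pure_price_of_stability_def
    by (rule optimal_welfare_ratio_ge[where w="\<lambda>s. welfare inst (outcome inst s)",
          OF eq_profile_equilibrium welfare_eq_profile])
      (rule ord_eq_le_trans[OF pure_equilibrium_imp_mixed(2)[symmetric]
            mixed_welfare_le_1[OF pure_equilibrium_imp_mixed(1)]]; simp)
  show "V \<le> mixed_price_of_stability inst"
    unfolding mixed_price_of_stability_def
    by (rule optimal_welfare_ratio_ge[where
          w="\<lambda>\<sigma>. \<integral>s. welfare inst (outcome inst s) \<partial>joint inst \<sigma>", OF pure_equilibrium_imp_mixed(1)[OF inst_simps(1) eq_profile_equilibrium]])
      (simp_all only: pure_equilibrium_imp_mixed(2)[OF inst_simps(1) eq_profile_equilibrium]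
        welfare_eq_profile mixed_welfare_le_1)
qed

end

theorem theorem16:
  fixes d :: nat and \<epsilon> :: real
  assumes "1 \<le> d" and "0 < \<epsilon>"
  shows "\<exists>I. (\<forall>i<bidders I. val I i \<in> SAW_class {..<items I} d) \<and>
             pure_equilibria I \<noteq> {} \<and>
             mixed_equilibria I \<noteq> {} \<and>
             pure_price_of_stability I \<ge> real d + 1 - \<epsilon> / real d \<and>
             mixed_price_of_stability I \<ge> real d + 1 - \<epsilon> / real d"
proof -
  \<comment> \<open>With \<open>\<beta> = 1 - \<delta> / (d + 1)\<close>, \<open>V\<close> equals
    \<open>d + 1 - \<delta>\<close>; the cap at 1 keeps \<open>\<beta>\<close> positive when
    \<open>\<epsilon>\<close> is large.\<close>
  define \<delta> where "\<delta> = min (\<epsilon> / real d) 1"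
  have \<delta>: "0 < \<delta>" "\<delta> \<le> 1" "\<delta> \<le> \<epsilon> / real d" using assms by (auto simp: \<delta>_def)
  interpret bundle_vs_single d "1 - \<delta> / real (Suc d)"
    by standard (use \<delta> assms in \<open>simp_all add: field_simps\<close>)
  have "real d + 1 - \<epsilon> / real d \<le> V"
    using \<delta> by (simp add: right_diff_distrib add.commute)
  then have "real d + 1 - \<epsilon> / real d \<le> pure_price_of_stability inst"
    and "real d + 1 - \<epsilon> / real d \<le> mixed_price_of_stability inst"
    using price_of_stability_ge by (auto intro: order_trans)
  moreover have "\<forall>i<bidders inst. val inst i \<in> SAW_class {..<items inst} d"
    using valuations by blast
  moreover have "pure_equilibria inst \<noteq> {}"
    using eq_profile_equilibrium by blast
  moreover have "mixed_equilibria inst \<noteq> {}"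
    using pure_equilibrium_imp_mixed(1)[OF inst_simps(1) eq_profile_equilibrium] by blast
  ultimately show ?thesis by blast
qed

end
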